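(* Let $\delta>0$, let $A\subset\mathbb{R}^d$ be a finite set and let $g:A\to\mathbb{R}^d$ be a map. Then the sunflower enclosure $F^s_{g,\delta}:K_\delta(A)\multimap\mathbb{R}^d$ of $g$ is an upper semicontinuous cubical map.
   Context: A $\delta$-elementary cube in $\mathbb{R}^d$ is a set $Q=[n_1\delta,m_1\delta]\times\cdots\times[n_d\delta,m_d\delta]$ with $n_i,m_i\in\mathbb{Z}$ and $m_i-n_i\in\{0,1\}$; $\mathcal{K}^d_\delta$ is the set of all of them. The associated cell $\mathring Q$ is the product of the open intervals $(n_i\delta,m_i\delta)$ when $n_i<m_i$ and of the points $\{n_i\delta\}$ when $n_i=m_i$. A cubical set is a finite union of $\delta$-elementary cubes. For a bounded $X\subset\mathbb{R}^d$ put $K_\delta(X):=\bigcup\{Q\in\mathcal{K}^d_\delta : X\cap Q\neq\emptyset\}$ (and $K_\delta(x):=K_\delta(\{x\})$) and $\llcorner X\urcorner_\delta:=\bigcup\{Q\in\mathcal{K}^d_\delta : \operatorname{conv}(X)\cap Q\ne\emptyset\}$, where $\operatorname{conv}$ denotes the convex hull. The sunflower enclosure of $g:A\to\mathbb{R}^d$ is the multivalued map $F^s_{g,\delta}:K_\delta(A)\multimap\mathbb{R}^d$, $F^s_{g,\delta}(x):=\llcorner g(K_\delta(x)\cap A)\urcorner_\delta$. A multivalued map $F:X\multimap\mathbb{R}^d$ assigns to each $x\in X$ a subset $F(x)\subset\mathbb{R}^d$. It is upper semicontinuous if $\{x\in X : F(x)\cap B\neq\emptyset\}$ is closed in $X$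 for every closed $B\subset\mathbb{R}^d$. It is cubical if (a) $X$ is a cubical set, (b) $F(x)$ is a cubical set for every $x\in X$, and (c) for every elementary cube $Q\subset X$ the restriction $F|_{\mathring Q}$ is constant. *)

theory Defs
  imports "HOL-Analysis.Analysis"
begin

definition cube_index :: "('d::finite \<Rightarrow> int) \<Rightarrow> ('d \<Rightarrow> int) \<Rightarrow> bool" where
  "cube_index n m \<longleftrightarrow> (\<forall>i. m i - n i \<in> {0, 1})"

definition cube :: "real \<Rightarrow> ('d::finite \<Rightarrow> int) \<Rightarrow> ('d \<Rightarrow> int) \<Rightarrow> (real ^ 'd) set" where
  "cube \<delta> n m = {x. \<forall>i. x $ i \<in> {real_of_int (n i) * \<delta> .. real_of_int (m i) * \<delta>}}"

text \<open>For positive \<open>\<delta>\<close> and \<open>cube_index n m\<close>, the set \<open>cube \<delta> n m\<close> determines \<open>n\<close> and \<open>m\<close>, so the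
  cell associated with a cube may be taken as a function of its corner indices.\<close>

definition cell :: "real \<Rightarrow> ('d::finite \<Rightarrow> int) \<Rightarrow> ('d \<Rightarrow> int) \<Rightarrow> (real ^ 'd) set" where
  "cell \<delta> n m =
    {x. \<forall>i. x $ i \<in> (if n i < m i
                       then {real_of_int (n i) * \<delta> <..< real_of_int (m i) * \<delta>}
                       else {real_of_int (n i) * \<delta>})}"

definition elementary_cubes :: "real \<Rightarrow> (real ^ 'd::finite) set set" where
  "elementary_cubes \<delta> = {cube \<delta> n m | n m. cube_index n m}"

definition cubical_set :: "real \<Rightarrow> (real ^ 'd::finite) set \<Rightarrow> bool" where
  "cubical_set \<delta> X \<longleftrightarrow> (\<exists>S. finite S \<and> S \<subseteq> elementary_cubes \<delta> \<and> X = \<Union>S)"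

definition cubical_nbhd :: "real \<Rightarrow> (real ^ 'd::finite) set \<Rightarrow> (real ^ 'd) set" where
  "cubical_nbhd \<delta> X = \<Union>{Q \<in> elementary_cubes \<delta>. X \<inter> Q \<noteq> {}}"

definition cubical_hull :: "real \<Rightarrow> (real ^ 'd::finite) set \<Rightarrow> (real ^ 'd) set" where
  "cubical_hull \<delta> X = \<Union>{Q \<in> elementary_cubes \<delta>. convex hull X \<inter> Q \<noteq> {}}"

text \<open>A multivalued map with domain \<open>X\<close> is represented by a set-valued function on the whole type,
  whose values outside \<open>X\<close> are irrelevant. In the same way, \<open>g\<close> below is only ever evaluated on
  \<open>A\<close>.\<close>

definition sunflower ::
  "(real ^ 'd::finite) set \<Rightarrow> (real ^ 'd \<Rightarrow> real ^ 'd) \<Rightarrow> real \<Rightarrow> real ^ 'd \<Rightarrow> (real ^ 'd) set" where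
  "sunflower A g \<delta> x = cubical_hull \<delta> (g ` (cubical_nbhd \<delta> {x} \<inter> A))"

definition upper_semicontinuous_on ::
  "(real ^ 'd::finite) set \<Rightarrow> (real ^ 'd \<Rightarrow> (real ^ 'd) set) \<Rightarrow> bool" where
  "upper_semicontinuous_on X F \<longleftrightarrow>
    (\<forall>B. closed B \<longrightarrow> closedin (top_of_set X) {x \<in> X. F x \<inter> B \<noteq> {}})"

definition cubical_map_on ::
  "real \<Rightarrow> (real ^ 'd::finite) set \<Rightarrow> (real ^ 'd \<Rightarrow> (real ^ 'd) set) \<Rightarrow> bool" where
  "cubical_map_on \<delta> X F \<longleftrightarrow>
    cubical_set \<delta> X \<and>
    (\<forall>x \<in> X. cubical_set \<delta> (F x)) \<and>
    (\<forall>n m. cube_index n m \<and> cube \<delta> n m \<subseteq> X \<longrightarrow> F constant_on cell \<delta> n m)"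

end

theory Submission
  imports Defs
begin

text \<open>Sharing an elementary cube is a symmetric relation on points, so the set of \<open>x\<close> whose
  neighbourhood contains a given finite set \<open>S\<close> is a finite intersection of the closed sets
  \<open>cubical_nbhd \<delta> {a}\<close> with \<open>a \<in> S\<close>. Since the cubical hull is monotone, the set of \<open>x\<close> at which
  the sunflower enclosure meets \<open>B\<close> is the union of such sets over the finitely many \<open>S \<subseteq> A\<close> for
  which the hull of \<open>g ` S\<close> meets \<open>B\<close>.\<close>

text \<open>A cube that meets a bounded set has its integer corners in a bounded range, so only
  finitely many pairs \<open>(n, m)\<close> can occur.\<close>

lemma finite_elementary_cubes_meeting_bounded:
  fixes X :: "(real ^ 'd::finite) set"
  assumes \<delta>: "\<delta> > 0" and "bounded X"
  shows "finite {Q \<in> elementary_cubes \<delta>. X \<inter> Q \<noteq> {}}"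
proof -
  obtain b where b: "\<And>x. x \<in> X \<Longrightarrow> norm x \<le> b"
    using \<open>bounded X\<close> by (auto simp: bounded_iff)
  \<comment> \<open>A point of the cube bounds \<open>n i\<close> only from above and
    \<open>m i\<close> only from below. The opposite bounds follow from
    \<open>m i - n i \<in> {0, 1}\<close> at the cost of the added 1.\<close>
  define k where "k = \<lceil>b / \<delta>\<rceil> + 1"
  define I where "I = Pi (UNIV :: 'd set) (\<lambda>_. {-k..k})"
  have "finite I"
    unfolding I_def by (metis PiE_UNIV_domain finite_PiE finite_atLeastAtMost_int finite_class.finite_UNIV)
  have "{Q \<in> elementary_cubes \<delta>. X \<inter> Q \<noteq> {}} \<subseteq> (\<lambda>(n, m). cube \<delta> n m) ` (I \<times> I)"
  proof
    fix Q assume "Q \<in> {Q \<in> elementary_cubes \<delta>. X \<inter> Q \<noteq> {}}"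
    then obtain n m x where nm: "cube_index n m" "Q = cube \<delta> n m" and x: "x \<in> X" "x \<in> Q"
      by (auto simp: elementary_cubes_def)
    have "n i \<in> {-k..k} \<and> m i \<in> {-k..k}" for i
    proof -
      have "\<bar>x $ i\<bar> \<le> b"
        using b[OF x(1)] component_le_norm_cart[of x i] by linarith
      moreover have "real_of_int (n i) * \<delta> \<le> x $ i" "x $ i \<le> real_of_int (m i) * \<delta>"
        using x(2) nm(2) by (auto simp: cube_def)
      ultimately have "real_of_int (n i) * \<delta> \<le> b" "- b \<le> real_of_int (m i) * \<delta>"
        by linarith+
      then have "real_of_int (n i) \<le> b / \<delta>" "- (b / \<delta>) \<le> real_of_int (m i)"
        using \<delta> by (simp_all add: field_simps)
      then have "n i \<le> \<lceil>b / \<delta>\<rceil>" "- \<lceil>b / \<delta>\<rceil> \<le> m i"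
        by linarith+
      moreover have "m i = n i \<or> m i = n i + 1"
        using nm(1) by (auto simp: cube_index_def dest: spec[of _ i])
      ultimately show ?thesis
        by (auto simp: k_def)
    qed
    then have "(n, m) \<in> I \<times> I"
      by (auto simp: I_def)
    then show "Q \<in> (\<lambda>(n, m). cube \<delta> n m) ` (I \<times> I)"
      using nm(2) by force
  qed
  then show ?thesis
    using \<open>finite I\<close> by (meson finite_SigmaI finite_imageI finite_subset)
qed

lemma cubical_set_cubical_nbhd:
  assumes "\<delta> > 0" and "bounded X"
  shows "cubical_set \<delta> (cubical_nbhd \<delta> X)"
  unfolding cubical_set_def cubical_nbhd_def
  using finite_elementary_cubes_meeting_bounded[OF assms] by blast

text \<open>Through this, the finiteness result for cubes serves the values of the enclosure as well
  as its domain.\<close>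

lemma cubical_hull_eq: "cubical_hull \<delta> X = cubical_nbhd \<delta> (convex hull X)"
  by (simp add: cubical_hull_def cubical_nbhd_def)

lemma cubical_hull_mono:
  assumes "X \<subseteq> Y"
  shows "cubical_hull \<delta> X \<subseteq> cubical_hull \<delta> Y"
  using hull_mono[OF assms, of convex] unfolding cubical_hull_def by blast

lemma cubical_set_imp_closed:
  assumes "cubical_set \<delta> X"
  shows "closed X"
proof -
  have "closed (cube \<delta> n m)" for n m :: "'a \<Rightarrow> int"
    unfolding cube_def atLeastAtMost_iff
    by (intro closed_Collect_all closed_Collect_conj closed_Collect_le continuous_intros)
  then show ?thesis
    using assms unfolding cubical_set_def elementary_cubes_def by (blast intro: closed_Union)
qed

lemma mem_cubical_nbhd_singleton_commute:
  "a \<in> cubical_nbhd \<delta> {x} \<longleftrightarrow> x \<in> cubical_nbhd \<delta> {a}"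
  by (auto simp: cubical_nbhd_def)

text \<open>In each coordinate a cell is either a single grid point or an open interval between
  consecutive multiples of \<open>\<delta>\<close>. No endpoint of another cube lies inside such an
  interval, so one common point forces containment.\<close>

lemma cell_subset_cube_if_meets:
  assumes "\<delta> > 0" and "cube_index n m" and x: "x \<in> cell \<delta> n m" "x \<in> cube \<delta> n' m'"
  shows "cell \<delta> n m \<subseteq> cube \<delta> n' m'"
proof
  fix y assume y: "y \<in> cell \<delta> n m"
  have "y $ i \<in> {real_of_int (n' i) * \<delta> .. real_of_int (m' i) * \<delta>}" for i
  proof (cases "n i < m i")
    case False
    then have "x $ i = y $ i"
      using x(1) y by (auto simp: cell_def dest!: spec[of _ i])
    then show ?thesis
      using x(2) by (simp add: cube_def flip: \<open>x $ i = y $ i\<close>)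
  next
    case True
    then have m: "m i = n i + 1"
      using assms(2) by (auto simp: cube_index_def dest: spec[of _ i])
    have xi: "real_of_int (n i) * \<delta> < x $ i" "x $ i < real_of_int (m i) * \<delta>"
      and yi: "real_of_int (n i) * \<delta> < y $ i" "y $ i < real_of_int (m i) * \<delta>"
      using x(1) y True by (auto simp: cell_def dest!: spec[of _ i])
    have "real_of_int (n' i) * \<delta> \<le> x $ i" "x $ i \<le> real_of_int (m' i) * \<delta>"
      using x(2) by (auto simp: cube_def)
    then have "real_of_int (n' i) * \<delta> < real_of_int (m i) * \<delta>"
      "real_of_int (n i) * \<delta> < real_of_int (m' i) * \<delta>"
      using xi by linarith+
    \<comment> \<open>After division by \<open>\<delta>\<close> these are strict inequalities
      between integers; with \<open>m i = n i + 1\<close> they sharpen to the containment of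
      intervals.\<close>
    then have "n' i \<le> n i" "m i \<le> m' i"
      using \<open>\<delta> > 0\<close> m by auto
    then have "real_of_int (n' i) * \<delta> \<le> real_of_int (n i) * \<delta>"
      "real_of_int (m i) * \<delta> \<le> real_of_int (m' i) * \<delta>"
      using \<open>\<delta> > 0\<close> by simp_all
    then show ?thesis
      using yi by simp
  qed
  then show "y \<in> cube \<delta> n' m'"
    by (simp add: cube_def)
qed

lemma cubical_nbhd_singleton_constant_on_cell:
  assumes "\<delta> > 0" and "cube_index n m" and "x \<in> cell \<delta> n m" and "y \<in> cell \<delta> n m"
  shows "cubical_nbhd \<delta> {x} = cubical_nbhd \<delta> {y}"
proof -
  have "x \<in> Q \<longleftrightarrow> y \<in> Q" if "Q \<in> elementary_cubes \<delta>" for Q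
    using that cell_subset_cube_if_meets[OF assms(1,2)] assms(3,4)
    by (auto simp: elementary_cubes_def)
  then show ?thesis
    by (auto simp: cubical_nbhd_def)
qed

text \<open>The domain \<open>X\<close> is arbitrary because the set in question is the trace on
  \<open>X\<close> of a set closed in the whole space.\<close>

lemma upper_semicontinuous_on_sunflower:
  assumes "\<delta> > 0" and "finite A"
  shows "upper_semicontinuous_on X (sunflower A g \<delta>)"
  unfolding upper_semicontinuous_on_def
proof (intro allI impI)
  fix B :: "(real ^ 'a) set"
  define \<S> where "\<S> = {S. S \<subseteq> A \<and> cubical_hull \<delta> (g ` S) \<inter> B \<noteq> {}}"
  have "finite \<S>"
    using \<open>finite A\<close> by (simp add: \<S>_def)
  have "sunflower A g \<delta> x \<inter> B \<noteq> {} \<longleftrightarrow> (\<exists>S\<in>\<S>. S \<subseteq> cubical_nbhd \<delta> {x})" for x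
  proof
    assume "sunflower A g \<delta> x \<inter> B \<noteq> {}"
    \<comment> \<open>The largest candidate serves as witness: all points of \<open>A\<close> that
      share a cube with \<open>x\<close>.\<close>
    then have "cubical_nbhd \<delta> {x} \<inter> A \<in> \<S>"
      by (auto simp: \<S>_def sunflower_def)
    then show "\<exists>S\<in>\<S>. S \<subseteq> cubical_nbhd \<delta> {x}"
      by blast
  next
    assume "\<exists>S\<in>\<S>. S \<subseteq> cubical_nbhd \<delta> {x}"
    then obtain S where S: "S \<in> \<S>" "S \<subseteq> cubical_nbhd \<delta> {x}"
      by blast
    then have "g ` S \<subseteq> g ` (cubical_nbhd \<delta> {x} \<inter> A)"
      by (auto simp: \<S>_def)
    from cubical_hull_mono[OF this] show "sunflower A g \<delta> x \<inter> B \<noteq> {}"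
      using S(1) unfolding \<S>_def sunflower_def by blast
  qed
  then have "{x \<in> X. sunflower A g \<delta> x \<inter> B \<noteq> {}}
      = X \<inter> (\<Union>S\<in>\<S>. \<Inter>a\<in>S. cubical_nbhd \<delta> {a})"
    by (auto simp: subset_iff mem_cubical_nbhd_singleton_commute)
  moreover have "closed (\<Union>S\<in>\<S>. \<Inter>a\<in>S. cubical_nbhd \<delta> {a})"
    using \<open>finite \<S>\<close> \<open>\<delta> > 0\<close>
    by (intro closed_UN closed_INT ballI)
      (auto intro: cubical_set_imp_closed cubical_set_cubical_nbhd)
  ultimately show "closedin (top_of_set X) {x \<in> X. sunflower A g \<delta> x \<inter> B \<noteq> {}}"
    by (simp add: closedin_closed_Int)
qed

theorem proposition1p1:
  fixes \<delta> :: real and A :: "(real ^ 'd::finite) set" and g :: "real ^ 'd \<Rightarrow> real ^ 'd"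
  assumes "\<delta> > 0" and "finite A"
  shows "upper_semicontinuous_on (cubical_nbhd \<delta> A) (sunflower A g \<delta>) \<and>
    cubical_map_on \<delta> (cubical_nbhd \<delta> A) (sunflower A g \<delta>)"
proof -
  have "cubical_set \<delta> (cubical_nbhd \<delta> A)"
    using assms by (intro cubical_set_cubical_nbhd finite_imp_bounded)
  moreover have "cubical_set \<delta> (sunflower A g \<delta> x)" for x
    unfolding sunflower_def cubical_hull_eq
    using assms by (intro cubical_set_cubical_nbhd bounded_convex_hull finite_imp_bounded) auto
  \<comment> \<open>The value at \<open>x\<close> depends on \<open>x\<close> only through
    \<open>cubical_nbhd \<delta> {x}\<close>.\<close>
  moreover have "sunflower A g \<delta> constant_on cell \<delta> n m" if "cube_index n m" for n m
    using cubical_nbhd_singleton_constant_on_cell[OF assms(1) that]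
    unfolding constant_on_def sunflower_def by metis
  ultimately show ?thesis
    using upper_semicontinuous_on_sunflower[OF assms] by (simp add: cubical_map_on_def)
qed

end
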